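(* Let $m\in\mathbb{N}$, $m\ge 1$, let $A\subseteq\mathbb{N}^m$ be a finite nonempty downward closed set of multi-indices, and for $i=1,\dots,m$ let $P_i=\{p_{0,i},\dots,p_{n_i,i}\}\subseteq[-1,1]$ consist of $n_i+1$ distinct points, where $n_i\ge\max_{\alpha\in A}\alpha_i$. Let $P_A=\{p_\alpha\}_{\alpha\in A}$ with $p_\alpha=(p_{\alpha_1,1},\dots,p_{\alpha_m,m})$, and let $f:\mathbb{R}^m\to\mathbb{R}$ be a function. Then the unique polynomial $Q_{f,A}\in\Pi_A$ interpolating $f$ in $P_A$, i.e. $Q_{f,A}(p)=f(p)$ for all $p\in P_A$, can be determined in $\mathcal{O}(|A|^2)$ operations requiring $\mathcal{O}(|A|)$ storage. It is given by $$Q_{f,A}(x)=\sum_{\alpha\in A}c_\alpha N_\alpha(x),$$ where $N_\alpha$ are the multivariate Newton polynomials and $c_\alpha$ are the Newton coefficients obtained by the multivariate divided difference scheme.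
   Context: $\mathbb{N}$ includes $0$. A set $A\subseteq\mathbb{N}^m$ is downward closed if $\alpha\in A$ and $\beta\in\mathbb{N}^m$ with $\beta_i\le\alpha_i$ for all $i$ imply $\beta\in A$. $\Pi_A=\mathrm{span}_{\mathbb{R}}\{x^\alpha:\alpha\in A\}$ with $x^\alpha=x_1^{\alpha_1}\cdots x_m^{\alpha_m}$. Multivariate Newton polynomials: $N_\alpha(x)=\prod_{i=1}^m\prod_{j=0}^{\alpha_i-1}(x_i-p_{j,i})$ for $\alpha\in A$ (empty products equal $1$). Multivariate divided differences: for $\alpha=(a_1,\dots,a_m)\in A$, $1\le i\le m$ and $0\le j<a_i$, let $\beta^{\alpha,i,j}\in A$ be the multi-index obtained from $\alpha$ by replacing its $i$-th entry by $j$. Define recursively $F_{\alpha,m,0}=f(p_\alpha)$; $F_{\alpha,i,0}=F_{\alpha,i+1,a_{i+1}}$ for $1\le i<m$; and $$F_{\alpha,i,j}=\frac{F_{\alpha,i,j-1}-F_{\beta^{\alpha,i,j-1},i,j-1}}{p_{a_i,i}-p_{j-1,i}}\qquad\text{for }1\le j\le a_i.$$ The Newton coefficients are $c_\alpha=F_{\alpha,1,a_1}$. Operations are arithmetic operations on real numbers, storage is the number of real numbers stored, and the input is the nodes and the values $f(p_\alpha)$, $\alpha\in A$. *)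

theory Defs
  imports Complex_Main "HOL-Library.FuncSet" "HOL-Library.Function_Algebras"
begin

text \<open>
  Coordinates are numbered \<open>1, \<dots>, m\<close>. Multi-indices and points are extensional functions on
  \<open>{1..m}\<close>, so that each element of \<open>\<nat>\<^sup>m\<close> and \<open>\<real>\<^sup>m\<close> has exactly one representative. Nodes are
  written \<open>p j i\<close> for $p_{j,i}$.
\<close>

type_synonym multi_index = "nat \<Rightarrow> nat"
type_synonym point = "nat \<Rightarrow> real"
type_synonym nodes = "nat \<Rightarrow> nat \<Rightarrow> real"

definition multi_indices :: "nat \<Rightarrow> multi_index set" where
  "multi_indices m = {1..m} \<rightarrow>\<^sub>E UNIV"

definition downward_closed :: "nat \<Rightarrow> multi_index set \<Rightarrow> bool" where
  "downward_closed m A \<longleftrightarrow>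
     (\<forall>\<alpha>\<in>A. \<forall>\<beta>\<in>multi_indices m. (\<forall>i\<in>{1..m}. \<beta> i \<le> \<alpha> i) \<longrightarrow> \<beta> \<in> A)"

definition monomial :: "nat \<Rightarrow> multi_index \<Rightarrow> point \<Rightarrow> real" where
  "monomial m \<alpha> x = (\<Prod>i\<in>{1..m}. x i ^ \<alpha> i)"

text \<open>
  Polynomials are real functions of \<open>x\<close>; the elements of \<open>poly_space m A\<close> only look at the
  coordinates \<open>x 1, \<dots>, x m\<close>, so equality of two of them is equality as functions on \<open>\<real>\<^sup>m\<close>.
\<close>

definition poly_space :: "nat \<Rightarrow> multi_index set \<Rightarrow> (point \<Rightarrow> real) set" where
  "poly_space m A = module.span (\<lambda>(c::real) g x. c * g x) (monomial m ` A)"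

definition grid_point :: "nat \<Rightarrow> nodes \<Rightarrow> multi_index \<Rightarrow> point" where
  "grid_point m p \<alpha> = (\<lambda>i\<in>{1..m}. p (\<alpha> i) i)"

definition admissible_nodes :: "nat \<Rightarrow> multi_index set \<Rightarrow> (nat \<Rightarrow> nat) \<Rightarrow> nodes \<Rightarrow> bool" where
  "admissible_nodes m A n p \<longleftrightarrow>
     (\<forall>i\<in>{1..m}. Max ((\<lambda>\<alpha>. \<alpha> i) ` A) \<le> n i \<and>
        inj_on (\<lambda>j. p j i) {0..n i} \<and> (\<lambda>j. p j i) ` {0..n i} \<subseteq> {-1..1})"

definition interpolates ::
    "nat \<Rightarrow> nodes \<Rightarrow> multi_index set \<Rightarrow> (point \<Rightarrow> real) \<Rightarrow> (point \<Rightarrow> real) \<Rightarrow> bool" where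
  "interpolates m p A f Q \<longleftrightarrow>
     Q \<in> poly_space m A \<and> (\<forall>x\<in>grid_point m p ` A. Q x = f x)"

definition newton_poly :: "nat \<Rightarrow> nodes \<Rightarrow> multi_index \<Rightarrow> point \<Rightarrow> real" where
  "newton_poly m p \<alpha> x = (\<Prod>i\<in>{1..m}. \<Prod>j<\<alpha> i. x i - p j i)"

text \<open>
  \<open>divided_diff m p f \<alpha> i j\<close> is $F_{\alpha,i,j}$, for \<open>1 \<le> i \<le> m\<close> and \<open>j \<le> \<alpha> i\<close>; other arguments are
  irrelevant. The multi-index $\beta^{\alpha,i,j}$ is \<open>\<alpha>(i := j)\<close>.
\<close>

function divided_diff ::
    "nat \<Rightarrow> nodes \<Rightarrow> (point \<Rightarrow> real) \<Rightarrow> multi_index \<Rightarrow> nat \<Rightarrow> nat \<Rightarrow> real" where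
  "divided_diff m p f \<alpha> i 0 =
     (if i < m then divided_diff m p f \<alpha> (Suc i) (\<alpha> (Suc i)) else f (grid_point m p \<alpha>))"
| "divided_diff m p f \<alpha> i (Suc j) =
     (divided_diff m p f \<alpha> i j - divided_diff m p f (\<alpha>(i := j)) i j) / (p (\<alpha> i) i - p j i)"
  by pat_completeness auto
termination
  by (relation "measures [\<lambda>(m, p, f, \<alpha>, i, j). m - i, \<lambda>(m, p, f, \<alpha>, i, j). j]") auto

definition newton_coeff ::
    "nat \<Rightarrow> nodes \<Rightarrow> (point \<Rightarrow> real) \<Rightarrow> multi_index \<Rightarrow> real" where
  "newton_coeff m p f \<alpha> = divided_diff m p f \<alpha> 1 (\<alpha> 1)"

text \<open>
  Algorithms are straight-line programs over real registers. A program names the input cells it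
  reads: \<open>Node j i\<close> holds $p_{j,i}$ and \<open>Value \<alpha>\<close> holds $f(p_\alpha)$. No real constants are available.
  A run fails (\<open>None\<close>) on reading a nonexistent input cell or an unset register and on
  division by zero.
\<close>

datatype arith_op = Add | Sub | Mul | Div

datatype input_cell = Node nat nat | Value multi_index

datatype instr = Load nat input_cell | Arith nat arith_op nat nat

type_synonym memory = "nat \<Rightarrow> real option"

fun arith :: "arith_op \<Rightarrow> real \<Rightarrow> real \<Rightarrow> real option" where
  "arith Add u v = Some (u + v)"
| "arith Sub u v = Some (u - v)"
| "arith Mul u v = Some (u * v)"
| "arith Div u v = (if v = 0 then None else Some (u / v))"

fun step :: "(input_cell \<Rightarrow> real option) \<Rightarrow> instr \<Rightarrow> memory \<Rightarrow> memory option" where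
  "step inp (Load r c) M =
     (case inp c of None \<Rightarrow> None | Some v \<Rightarrow> Some (M(r \<mapsto> v)))"
| "step inp (Arith r q s t) M =
     (case (M s, M t) of
        (Some u, Some v) \<Rightarrow> (case arith q u v of None \<Rightarrow> None | Some w \<Rightarrow> Some (M(r \<mapsto> w)))
      | _ \<Rightarrow> None)"

fun run :: "(input_cell \<Rightarrow> real option) \<Rightarrow> instr list \<Rightarrow> memory \<Rightarrow> memory option" where
  "run inp [] M = Some M"
| "run inp (c # cs) M = (case step inp c M of None \<Rightarrow> None | Some M' \<Rightarrow> run inp cs M')"

fun problem_input ::
    "nat \<Rightarrow> multi_index set \<Rightarrow> (nat \<Rightarrow> nat) \<Rightarrow> nodes \<Rightarrow> (point \<Rightarrow> real) \<Rightarrow> input_cell \<Rightarrow> real option"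
where
  "problem_input m A n p f (Node j i) = (if i \<in> {1..m} \<and> j \<le> n i then Some (p j i) else None)"
| "problem_input m A n p f (Value \<alpha>) = (if \<alpha> \<in> A then Some (f (grid_point m p \<alpha>)) else None)"

fun is_arith :: "instr \<Rightarrow> bool" where
  "is_arith (Load r c) = False"
| "is_arith (Arith r q s t) = True"

definition operations :: "instr list \<Rightarrow> nat" where
  "operations prog = length (filter is_arith prog)"

fun registers :: "instr \<Rightarrow> nat set" where
  "registers (Load r c) = {r}"
| "registers (Arith r q s t) = {r, s, t}"

fun inputs :: "instr \<Rightarrow> input_cell set" where
  "inputs (Load r c) = {c}"
| "inputs (Arith r q s t) = {}"

text \<open>
  Storage counts every real number held anywhere: the working registers and also the input cells
  that are read, so the input is not free read-only memory.
\<close>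

definition storage :: "instr list \<Rightarrow> nat" where
  "storage prog = card (\<Union>(registers ` set prog)) + card (\<Union>(inputs ` set prog))"

text \<open>
  Starting from empty memory, the program ends with \<open>c \<alpha>\<close> in register \<open>out \<alpha>\<close> for all \<open>\<alpha> \<in> A\<close>
  simultaneously.
\<close>

definition computes ::
    "(input_cell \<Rightarrow> real option) \<Rightarrow> instr list \<Rightarrow> (multi_index \<Rightarrow> nat) \<Rightarrow> multi_index set \<Rightarrow>
     (multi_index \<Rightarrow> real) \<Rightarrow> bool" where
  "computes inp prog out A c \<longleftrightarrow>
     (\<exists>M. run inp prog Map.empty = Some M \<and> (\<forall>\<alpha>\<in>A. M (out \<alpha>) = Some (c \<alpha>)))"

end

theory Submission
  imports Defs
begin

text \<open>
  Newton polynomials with nodes \<open>p\<close> and with nodes \<open>q\<close> span the same space over a downward closed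
  \<open>A\<close>; monomials are the Newton polynomials with all nodes \<open>0\<close>, so \<open>poly_space m A\<close> consists of
  the combinations of the \<open>newton_poly m p \<alpha>\<close> with \<open>\<alpha> \<in> A\<close> (\<open>poly_space_eq_newton_range\<close>). In this
  basis interpolation is a triangular system: \<open>newton_poly m p \<beta>\<close> vanishes at \<open>grid_point m p \<alpha>\<close>
  unless \<open>\<beta> \<le> \<alpha>\<close>, and it does not vanish if \<open>\<beta> = \<alpha>\<close>. Hence there is at most one interpolant
  (\<open>interpolant_unique\<close>).

  That the divided differences solve this system is the one-dimensional Newton formula applied to
  one coordinate after another. Stage \<open>i\<close> of the scheme takes, along each line in direction \<open>i\<close>,
  the function values produced by stage \<open>i + 1\<close> to the coefficients of their univariate Newton
  interpolant. Inverting a stage therefore means evaluating a univariate Newton sum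
  (\<open>stage_value_newton_expansion\<close>), and inverting all of them writes \<open>f (grid_point m p \<alpha>)\<close> as a sum
  over the box below \<open>\<alpha>\<close> (\<open>value_eq_sum_stage_values\<close>), which is the Newton sum at that grid point.

  For the complexity, the scheme is run in place, with one register for each \<open>\<alpha> \<in> A\<close> and two
  auxiliary ones. There is one update for each triple \<open>(i, j, \<alpha>)\<close> with \<open>j < \<alpha> i\<close>, and it takes three
  operations. The map \<open>(i, j, \<alpha>) \<mapsto> (\<alpha>, \<alpha>(i := j))\<close> embeds these triples into \<open>A \<times> A\<close>
  (\<open>card_predecessors_le\<close>), which gives the quadratic bound independently of the dimension. Only
  nodes in directions in which \<open>A\<close> extends are read, at most two for each nonzero element of \<open>A\<close> on a
  coordinate axis (\<open>card_nodes_le\<close>), so storage is linear in \<open>card A\<close> even when \<open>m\<close> is larger.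
\<close>

section \<open>Downward closed sets\<close>

definition leq_index :: "nat \<Rightarrow> multi_index \<Rightarrow> multi_index \<Rightarrow> bool" where
  "leq_index m \<beta> \<alpha> \<longleftrightarrow> \<beta> \<in> multi_indices m \<and> (\<forall>i\<in>{1..m}. \<beta> i \<le> \<alpha> i)"

lemma multi_indices_eqI:
  assumes "\<alpha> \<in> multi_indices m" "\<beta> \<in> multi_indices m" "\<And>i. i \<in> {1..m} \<Longrightarrow> \<alpha> i = \<beta> i"
  shows "\<alpha> = \<beta>"
  using assms unfolding multi_indices_def by (metis PiE_ext)

lemma multi_indices_upd:
  assumes "\<alpha> \<in> multi_indices m" "i \<in> {1..m}"
  shows "\<alpha>(i := j) \<in> multi_indices m"
  using assms by (auto simp: multi_indices_def PiE_iff extensional_def)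

lemma downward_closedD:
  "downward_closed m A \<Longrightarrow> \<alpha> \<in> A \<Longrightarrow> leq_index m \<beta> \<alpha> \<Longrightarrow> \<beta> \<in> A"
  unfolding downward_closed_def leq_index_def by blast

lemma downward_closed_upd:
  assumes "downward_closed m A" "A \<subseteq> multi_indices m" "\<alpha> \<in> A" "i \<in> {1..m}" "j \<le> \<alpha> i"
  shows "\<alpha>(i := j) \<in> A"
  using assms(3,5) multi_indices_upd[OF subsetD[OF assms(2,3)] assms(4)]
  by (intro downward_closedD[OF assms(1,3)]) (auto simp: leq_index_def)

lemma entry_less_card:
  assumes "downward_closed m A" "A \<subseteq> multi_indices m" "finite A" "\<alpha> \<in> A" "i \<in> {1..m}"
  shows "\<alpha> i < card A"
proof -
  have "inj_on (\<lambda>j. \<alpha>(i := j)) {..\<alpha> i}"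
    by (auto simp: inj_on_def dest: fun_cong[of _ _ i])
  moreover have "(\<lambda>j. \<alpha>(i := j)) ` {..\<alpha> i} \<subseteq> A"
    using downward_closed_upd[OF assms(1,2,4,5)] by auto
  ultimately have "card {..\<alpha> i} \<le> card A"
    using assms(3) by (meson card_inj_on_le)
  then show ?thesis by simp
qed

text \<open>
  The scheme performs one update per triple \<open>(i, j, \<alpha>)\<close>. Summing over \<open>i\<close> crudely would cost a
  factor \<open>m\<close>; but \<open>\<alpha>\<close> and \<open>\<alpha>(i := j)\<close> differ exactly in coordinate \<open>i\<close>, where the latter has entry
  \<open>j\<close>, so this pair of elements of \<open>A\<close> determines the triple.
\<close>

lemma card_predecessors_le:
  assumes "downward_closed m A" "A \<subseteq> multi_indices m" "finite A"
  shows "card {(i, j, \<alpha>). i \<in> {1..m} \<and> \<alpha> \<in> A \<and> j < \<alpha> i} \<le> (card A)\<^sup>2"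
proof -
  let ?T = "{(i, j, \<alpha>). i \<in> {1..m} \<and> \<alpha> \<in> A \<and> j < \<alpha> i}"
  let ?h = "\<lambda>(i, j, \<alpha>). (\<alpha>, \<alpha>(i := j))"
  have key: "i = i' \<and> j = j'"
    if "j < \<alpha> i" "j' < \<alpha> i'" "\<alpha>(i := j) = \<alpha>(i' := j')" for i j i' j' and \<alpha> :: multi_index
  proof -
    have "i = i'"
      using fun_cong[OF that(3), of i] that(1) by (simp split: if_splits)
    then show ?thesis
      using fun_cong[OF that(3), of i] by simp
  qed
  have "inj_on ?h ?T"
  proof (rule inj_onI)
    fix s t assume s: "s \<in> ?T" and t: "t \<in> ?T" and eq: "?h s = ?h t"
    obtain i j \<alpha> i' j' \<alpha>' where st: "s = (i, j, \<alpha>)" "t = (i', j', \<alpha>')"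
      by (metis prod_cases3)
    have "\<alpha> = \<alpha>' \<and> \<alpha>(i := j) = \<alpha>'(i' := j')"
      using eq unfolding st prod.case prod.inject .
    then show "s = t"
      using key[of j \<alpha> i j' i'] s t unfolding st by blast
  qed
  moreover have "?h ` ?T \<subseteq> A \<times> A"
  proof (rule image_subsetI)
    fix s assume "s \<in> ?T"
    then obtain i j \<alpha> where "s = (i, j, \<alpha>)" "i \<in> {1..m}" "\<alpha> \<in> A" "j < \<alpha> i"
      by blast
    then show "?h s \<in> A \<times> A"
      using downward_closed_upd[OF assms(1,2), of \<alpha> i j] by (simp del: atLeastAtMost_iff)
  qed
  ultimately have "card ?T \<le> card (A \<times> A)"
    using assms(3) by (intro card_inj_on_le[of ?h]) auto
  then show ?thesis
    by (simp add: power2_eq_square card_cartesian_product)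
qed

definition axis_index :: "nat \<Rightarrow> nat \<Rightarrow> nat \<Rightarrow> multi_index" where
  "axis_index m i k = (\<lambda>l\<in>{1..m}. if l = i then k else 0)"

text \<open>
  These are the nodes that the program reads. For \<open>k > 0\<close>, the node \<open>(k, i)\<close> is recorded by the
  element of \<open>A\<close> with entry \<open>k\<close> at \<open>i\<close> and \<open>0\<close> elsewhere. The remaining nodes, those with \<open>k = 0\<close>,
  occur only in directions that also contain a node with \<open>k > 0\<close>, so they at most double the count.
  The condition \<open>0 < \<alpha> i\<close> is essential: \<open>A = {0}\<close> would otherwise involve \<open>m\<close> nodes.
\<close>

lemma card_nodes_le:
  assumes "downward_closed m A" "finite A"
  shows "finite {Node k i |k i. \<exists>\<alpha>\<in>A. i \<in> {1..m} \<and> k \<le> \<alpha> i \<and> 0 < \<alpha> i}" (is "finite ?N")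
    and "card {Node k i |k i. \<exists>\<alpha>\<in>A. i \<in> {1..m} \<and> k \<le> \<alpha> i \<and> 0 < \<alpha> i} \<le> 2 * card A"
proof -
  define S where "S = {(k, i). i \<in> {1..m} \<and> 0 < k \<and> axis_index m i k \<in> A}"
  have inj: "inj_on (\<lambda>(k, i). axis_index m i k) S"
  proof (rule inj_onI, clarify)
    fix k i k' i'
    assume *: "(k, i) \<in> S" "(k', i') \<in> S" "axis_index m i k = axis_index m i' k'"
    then have "axis_index m i k i = axis_index m i' k' i" by simp
    then show "k = k' \<and> i = i'"
      using *(1,2) unfolding S_def axis_index_def by (auto split: if_splits)
  qed
  have sub: "(\<lambda>(k, i). axis_index m i k) ` S \<subseteq> A"
    unfolding S_def by auto
  have finS: "finite S" and cardS: "card S \<le> card A"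
    using inj_on_finite[OF inj sub assms(2)] card_inj_on_le[OF inj sub assms(2)] by auto
  have axis: "axis_index m i k \<in> A" if "\<alpha> \<in> A" "i \<in> {1..m}" "k \<le> \<alpha> i" for \<alpha> i k
    using that by (intro downward_closedD[OF assms(1) that(1)])
      (auto simp: leq_index_def axis_index_def multi_indices_def)
  let ?I = "(\<lambda>(k, i). Node k i) ` S \<union> (\<lambda>(k, i). Node 0 i) ` S"
  have N: "?N \<subseteq> ?I"
  proof clarify
    fix k i \<alpha>
    assume *: "\<alpha> \<in> A" "i \<in> {1..m}" "k \<le> \<alpha> i" "0 < \<alpha> i"
      "Node k i \<notin> (\<lambda>(k, i). Node 0 i) ` S"
    have "(\<alpha> i, i) \<in> S"
      using * axis unfolding S_def by auto
    \<comment> \<open>A node with \<open>k = 0\<close> would lie in the second part, through the pair \<open>(\<alpha> i, i)\<close>.\<close>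
    then have "k \<noteq> 0"
      using *(5) by force
    then have "(k, i) \<in> S"
      using * axis unfolding S_def by auto
    then show "Node k i \<in> (\<lambda>(k, i). Node k i) ` S"
      by force
  qed
  then show "finite ?N"
    using finS by (auto intro: finite_subset)
  have "card ?N \<le> card ?I"
    using N finS by (intro card_mono) auto
  also have "\<dots> \<le> card S + card S"
    by (rule order_trans[OF card_Un_le]) (intro add_mono card_image_le finS)
  finally show "card ?N \<le> 2 * card A"
    using cardS by linarith
qed

section \<open>The Newton basis\<close>

text \<open>
  This makes the passage from monomials to the Newton basis an instance of a change of nodes.
\<close>

lemma monomial_eq_newton_poly: "monomial m = newton_poly m (\<lambda>_ _. 0)"
  by (simp add: fun_eq_iff monomial_def newton_poly_def)

lemma newton_poly_Suc:
  assumes "i \<in> {1..m}"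
  shows "newton_poly m p (\<beta>(i := Suc (\<beta> i))) x = (x i - p (\<beta> i) i) * newton_poly m p \<beta> x"
  using assms by (simp add: newton_poly_def prod.remove[of _ i] cong: prod.cong_simp)

context
begin

interpretation fun_space: vector_space "\<lambda>(c::real) (g :: point \<Rightarrow> real) x. c * g x"
  by unfold_locales (auto simp: fun_eq_iff algebra_simps)

text \<open>
  A factor \<open>x i - c\<close> with an arbitrary \<open>c\<close> raises entry \<open>i\<close> by at most one, since
  \<open>x i - c = (x i - p (\<beta> i) i) + (p (\<beta> i) i - c)\<close>: the first summand extends the Newton polynomial of
  \<open>\<beta>\<close> and the second one is a scalar.
\<close>

private lemma span_mult_linear_factor:
  assumes g: "g \<in> fun_space.span (newton_poly m p ` {\<beta>. leq_index m \<beta> \<alpha>})"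
    and i: "i \<in> {1..m}"
  shows "(\<lambda>x. (x i - c) * g x)
    \<in> fun_space.span (newton_poly m p ` {\<beta>. leq_index m \<beta> (\<alpha>(i := Suc (\<alpha> i)))})"
    (is "_ \<in> fun_space.span ?B")
  using g
proof (induction rule: fun_space.span_induct_alt)
  case base
  have "(\<lambda>x. (x i - c) * (0 :: point \<Rightarrow> real) x) = 0"
    by (auto simp: fun_eq_iff)
  then show ?case by (metis fun_space.span_zero)
next
  case (step a h g)
  obtain \<beta> where h: "h = newton_poly m p \<beta>" and \<beta>: "leq_index m \<beta> \<alpha>"
    using step.hyps by auto
  have up: "leq_index m (\<beta>(i := Suc (\<beta> i))) (\<alpha>(i := Suc (\<alpha> i)))"
    using \<beta> i multi_indices_upd[OF _ i] by (auto simp: leq_index_def)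
  have here: "leq_index m \<beta> (\<alpha>(i := Suc (\<alpha> i)))"
    using \<beta> i by (auto simp: leq_index_def intro: le_SucI)
  have terms:
    "(\<lambda>x. a * newton_poly m p (\<beta>(i := Suc (\<beta> i))) x) \<in> fun_space.span ?B"
    "(\<lambda>x. (a * (p (\<beta> i) i - c)) * newton_poly m p \<beta> x) \<in> fun_space.span ?B"
    by (rule fun_space.span_scale, rule fun_space.span_base, use up here in blast)+
  have "(\<lambda>x. (x i - c) * ((\<lambda>x. a * h x) + g) x) =
      (\<lambda>x. a * newton_poly m p (\<beta>(i := Suc (\<beta> i))) x)
      + (\<lambda>x. (a * (p (\<beta> i) i - c)) * newton_poly m p \<beta> x) + (\<lambda>x. (x i - c) * g x)"
    unfolding h by (simp add: fun_eq_iff newton_poly_Suc[OF i] algebra_simps)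
  also have "\<dots> \<in> fun_space.span ?B"
    by (intro fun_space.span_add terms step.IH)
  finally show ?case .
qed

text \<open>
  The linear factors of \<open>newton_poly m q \<alpha>\<close> are multiplied in one at a time, by induction on the
  degree \<open>\<Sum>i. \<alpha> i\<close>.
\<close>

private lemma newton_poly_in_span:
  assumes "\<alpha> \<in> multi_indices m"
  shows "newton_poly m q \<alpha> \<in> fun_space.span (newton_poly m p ` {\<beta>. leq_index m \<beta> \<alpha>})"
  using assms
proof (induction "\<Sum>i\<in>{1..m}. \<alpha> i" arbitrary: \<alpha>)
  case 0
  then have "newton_poly m q \<alpha> = newton_poly m p \<alpha>"
    by (simp add: fun_eq_iff newton_poly_def)
  then show ?case
    using 0 by (auto simp: leq_index_def intro: fun_space.span_base)
next
  case (Suc s)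
  then obtain i where i: "i \<in> {1..m}" "\<alpha> i \<noteq> 0"
    by (metis (no_types, lifting) nat.distinct(1) sum.neutral)
  define \<gamma> where "\<gamma> = \<alpha>(i := \<alpha> i - 1)"
  have \<alpha>: "\<alpha> = \<gamma>(i := Suc (\<gamma> i))"
    using i by (auto simp: \<gamma>_def)
  have \<gamma>: "\<gamma> \<in> multi_indices m"
    using multi_indices_upd[OF Suc.prems i(1)] by (simp add: \<gamma>_def)
  have "(\<Sum>i\<in>{1..m}. \<alpha> i) = Suc (\<Sum>i\<in>{1..m}. \<gamma> i)"
    using i(1) by (subst \<alpha>) (simp add: sum.remove[of _ i] cong: sum.cong_simp)
  with Suc.hyps \<gamma> have
    "newton_poly m q \<gamma> \<in> fun_space.span (newton_poly m p ` {\<beta>. leq_index m \<beta> \<gamma>})"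
    by simp
  from span_mult_linear_factor[OF this i(1), of "q (\<gamma> i) i"] show ?case
    using newton_poly_Suc[OF i(1), of q \<gamma>] \<alpha> by (metis (no_types, lifting) ext)
qed

private lemma poly_space_eq_newton_span:
  assumes "A \<subseteq> multi_indices m" "downward_closed m A"
  shows "poly_space m A = fun_space.span (newton_poly m p ` A)"
proof -
  have sub: "fun_space.span (newton_poly m q ` A) \<subseteq> fun_space.span (newton_poly m p ` A)" for p q
  proof (rule fun_space.span_minimal)
    show "newton_poly m q ` A \<subseteq> fun_space.span (newton_poly m p ` A)"
    proof clarify
      fix \<alpha> assume "\<alpha> \<in> A"
      then have "newton_poly m p ` {\<beta>. leq_index m \<beta> \<alpha>} \<subseteq> newton_poly m p ` A"
        using downward_closedD[OF assms(2)] by blast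
      with newton_poly_in_span[of \<alpha> m q p] \<open>\<alpha> \<in> A\<close> assms(1)
      show "newton_poly m q \<alpha> \<in> fun_space.span (newton_poly m p ` A)"
        using fun_space.span_mono by blast
    qed
  qed simp
  show ?thesis
    unfolding poly_space_def monomial_eq_newton_poly using sub by blast
qed

private lemma newton_span_eq:
  assumes "finite A"
  shows "fun_space.span (newton_poly m p ` A) =
    range (\<lambda>d x. \<Sum>\<alpha>\<in>A. d \<alpha> * newton_poly m p \<alpha> x)" (is "_ = ?T")
proof (rule fun_space.span_unique)
  show "newton_poly m p ` A \<subseteq> ?T"
  proof clarify
    fix \<alpha> assume "\<alpha> \<in> A"
    then have "newton_poly m p \<alpha> = (\<lambda>x. \<Sum>\<beta>\<in>A. (if \<beta> = \<alpha> then 1 else 0) * newton_poly m p \<beta> x)"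
      using assms by (intro ext) (simp add: if_distrib[of "\<lambda>c. c * _"] sum.delta cong: if_cong)
    then show "newton_poly m p \<alpha> \<in> ?T" by fast
  qed
  show "fun_space.subspace ?T"
  proof (rule fun_space.subspaceI)
    show "0 \<in> ?T"
      by (rule range_eqI[of _ _ "\<lambda>_. 0"]) (simp add: fun_eq_iff)
  next
    fix g h assume "g \<in> ?T" "h \<in> ?T"
    then obtain d e where "g = (\<lambda>x. \<Sum>\<alpha>\<in>A. d \<alpha> * newton_poly m p \<alpha> x)"
      "h = (\<lambda>x. \<Sum>\<alpha>\<in>A. e \<alpha> * newton_poly m p \<alpha> x)" by auto
    then show "g + h \<in> ?T"
      by (intro range_eqI[of _ _ "\<lambda>\<alpha>. d \<alpha> + e \<alpha>"]) (simp add: fun_eq_iff sum.distrib distrib_right)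
  next
    fix c g assume "g \<in> ?T"
    then obtain d where "g = (\<lambda>x. \<Sum>\<alpha>\<in>A. d \<alpha> * newton_poly m p \<alpha> x)" by auto
    then show "(\<lambda>x. c * g x) \<in> ?T"
      by (intro range_eqI[of _ _ "\<lambda>\<alpha>. c * d \<alpha>"]) (simp add: fun_eq_iff sum_distrib_left mult.assoc)
  qed
next
  fix T' assume T': "newton_poly m p ` A \<subseteq> T'" "fun_space.subspace T'"
  show "?T \<subseteq> T'"
  proof clarify
    fix d
    have "(\<lambda>x. \<Sum>\<alpha>\<in>B. d \<alpha> * newton_poly m p \<alpha> x) \<in> T'" if "B \<subseteq> A" for B
      using finite_subset[OF that assms] that
    proof (induction B rule: finite_induct)
      case empty
      then show ?case
        using fun_space.subspace_0[OF T'(2)] by (simp add: zero_fun_def)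
    next
      case (insert \<alpha> B)
      have "(\<lambda>x. d \<alpha> * newton_poly m p \<alpha> x) + (\<lambda>x. \<Sum>\<alpha>\<in>B. d \<alpha> * newton_poly m p \<alpha> x) \<in> T'"
        using insert T' by (intro fun_space.subspace_add fun_space.subspace_scale) auto
      then show ?case
        using insert.hyps by (simp add: plus_fun_def)
    qed
    then show "(\<lambda>x. \<Sum>\<alpha>\<in>A. d \<alpha> * newton_poly m p \<alpha> x) \<in> T'" by simp
  qed
qed

lemma poly_space_eq_newton_range:
  assumes "A \<subseteq> multi_indices m" "finite A" "downward_closed m A"
  shows "poly_space m A = range (\<lambda>d x. \<Sum>\<alpha>\<in>A. d \<alpha> * newton_poly m p \<alpha> x)"
  using poly_space_eq_newton_span[OF assms(1,3)] newton_span_eq[OF assms(2)] by simp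

end

section \<open>Uniqueness\<close>

text \<open>
  What interpolation needs from the nodes: the denominators of the divided differences, and thereby
  the diagonal entries of the triangular system, are nonzero.
\<close>

definition separating_nodes :: "nat \<Rightarrow> multi_index set \<Rightarrow> nodes \<Rightarrow> bool" where
  "separating_nodes m A p \<longleftrightarrow> (\<forall>\<alpha>\<in>A. \<forall>i\<in>{1..m}. \<forall>j<\<alpha> i. p (\<alpha> i) i \<noteq> p j i)"

lemma admissible_imp_le:
  assumes "admissible_nodes m A n p" "finite A" "\<alpha> \<in> A" "i \<in> {1..m}"
  shows "\<alpha> i \<le> n i"
proof -
  have "\<alpha> i \<le> Max ((\<lambda>\<alpha>. \<alpha> i) ` A)"
    using assms by (intro Max_ge) auto
  also have "\<dots> \<le> n i"
    using assms by (auto simp: admissible_nodes_def)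
  finally show ?thesis .
qed

lemma admissible_imp_separating:
  assumes "admissible_nodes m A n p" "finite A"
  shows "separating_nodes m A p"
  unfolding separating_nodes_def
proof (intro ballI allI impI notI)
  fix \<alpha> i j assume *: "\<alpha> \<in> A" "i \<in> {1..m}" "j < \<alpha> i" "p (\<alpha> i) i = p j i"
  have "inj_on (\<lambda>j. p j i) {0..n i}" "\<alpha> i \<le> n i"
    using assms *(1,2) admissible_imp_le by (auto simp: admissible_nodes_def)
  then show False
    using *(3,4) by (auto dest!: inj_onD)
qed

text \<open>
  If \<open>\<beta> i > \<alpha> i\<close>, then the factor for \<open>j = \<alpha> i\<close> occurs in the Newton polynomial and vanishes at the
  grid point.
\<close>

lemma newton_poly_grid_eq_0:
  assumes "\<beta> \<in> multi_indices m" "\<not> leq_index m \<beta> \<alpha>"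
  shows "newton_poly m p \<beta> (grid_point m p \<alpha>) = 0"
proof -
  obtain i where "i \<in> {1..m}" "\<alpha> i < \<beta> i"
    using assms by (auto simp: leq_index_def not_le)
  moreover from this have "(\<Prod>j<\<beta> i. grid_point m p \<alpha> i - p j i) = 0"
    by (auto simp: grid_point_def intro!: bexI[of _ "\<alpha> i"])
  ultimately show ?thesis
    unfolding newton_poly_def by (intro prod_zero) auto
qed

lemma newton_poly_grid_diag_nonzero:
  assumes "separating_nodes m A p" "\<alpha> \<in> A"
  shows "newton_poly m p \<alpha> (grid_point m p \<alpha>) \<noteq> 0"
  using assms by (auto simp: newton_poly_def grid_point_def separating_nodes_def)

text \<open>
  Forward substitution in the triangular system, along the degree: at the grid point of \<open>\<alpha>\<close> the
  indices not below \<open>\<alpha>\<close> contribute nothing, and those strictly below have coefficient \<open>0\<close> already.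
\<close>

lemma newton_coefficients_unique:
  assumes A: "A \<subseteq> multi_indices m" "finite A" and sep: "separating_nodes m A p"
    and zero: "\<And>\<alpha>. \<alpha> \<in> A \<Longrightarrow> (\<Sum>\<beta>\<in>A. d \<beta> * newton_poly m p \<beta> (grid_point m p \<alpha>)) = 0"
    and "\<alpha> \<in> A"
  shows "d \<alpha> = 0"
  using \<open>\<alpha> \<in> A\<close>
proof (induction "\<Sum>i\<in>{1..m}. \<alpha> i" arbitrary: \<alpha> rule: less_induct)
  case less
  have "d \<beta> * newton_poly m p \<beta> (grid_point m p \<alpha>) = 0" if \<beta>: "\<beta> \<in> A" "\<beta> \<noteq> \<alpha>" for \<beta>
  proof (cases "leq_index m \<beta> \<alpha>")
    case True
    have "\<exists>i\<in>{1..m}. \<beta> i < \<alpha> i"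
    proof (rule ccontr)
      assume "\<not> (\<exists>i\<in>{1..m}. \<beta> i < \<alpha> i)"
      then have "\<beta> = \<alpha>"
        using True A(1) \<beta> less.prems
        by (intro multi_indices_eqI[of \<beta> m \<alpha>]) (auto simp: leq_index_def not_less intro: le_antisym)
      with \<beta> show False by simp
    qed
    then have "(\<Sum>i\<in>{1..m}. \<beta> i) < (\<Sum>i\<in>{1..m}. \<alpha> i)"
      using True by (intro sum_strict_mono_ex1) (auto simp: leq_index_def)
    then show ?thesis
      using less.hyps \<beta> by simp
  next
    case False
    then show ?thesis
      using newton_poly_grid_eq_0 \<beta> A by auto
  qed
  then have "(\<Sum>\<beta>\<in>A - {\<alpha>}. d \<beta> * newton_poly m p \<beta> (grid_point m p \<alpha>)) = 0"
    by (intro sum.neutral) blast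
  then have "(\<Sum>\<beta>\<in>A. d \<beta> * newton_poly m p \<beta> (grid_point m p \<alpha>))
      = d \<alpha> * newton_poly m p \<alpha> (grid_point m p \<alpha>)"
    using less.prems A(2) by (simp add: sum.remove[of _ \<alpha>])
  then show ?case
    using zero[OF less.prems] newton_poly_grid_diag_nonzero[OF sep less.prems] by simp
qed

lemma interpolant_unique:
  assumes A: "A \<subseteq> multi_indices m" "finite A" "downward_closed m A"
    and sep: "separating_nodes m A p"
    and Q: "interpolates m p A f Q" and R: "interpolates m p A f R"
  shows "Q = R"
proof -
  obtain d e where d: "Q = (\<lambda>x. \<Sum>\<alpha>\<in>A. d \<alpha> * newton_poly m p \<alpha> x)"
    and e: "R = (\<lambda>x. \<Sum>\<alpha>\<in>A. e \<alpha> * newton_poly m p \<alpha> x)"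
    using Q R unfolding interpolates_def poly_space_eq_newton_range[OF A, of p] by blast
  have eq: "(\<Sum>\<beta>\<in>A. (d \<beta> - e \<beta>) * newton_poly m p \<beta> (grid_point m p \<alpha>)) = 0" if "\<alpha> \<in> A" for \<alpha>
  proof -
    have "Q (grid_point m p \<alpha>) = R (grid_point m p \<alpha>)"
      using Q R that by (simp add: interpolates_def)
    then show ?thesis
      by (simp add: d e left_diff_distrib sum_subtractf)
  qed
  have "d \<alpha> - e \<alpha> = 0" if "\<alpha> \<in> A" for \<alpha>
    using newton_coefficients_unique[OF A(1,2) sep eq that] .
  then show ?thesis
    by (auto simp: d e)
qed

section \<open>Divided differences are the Newton coefficients\<close>

text \<open>
  The result of stage \<open>i\<close> at \<open>\<alpha>\<close>, that is $F_{\alpha,i,\alpha_i}$. The stages run from \<open>i = m\<close> down to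
  \<open>i = 1\<close>; letting the index \<open>Suc m\<close> stand for the given values makes the transition from \<open>Suc i\<close> to
  \<open>i\<close> uniform, including the first one.
\<close>

definition stage_value :: "nat \<Rightarrow> nodes \<Rightarrow> (point \<Rightarrow> real) \<Rightarrow> nat \<Rightarrow> multi_index \<Rightarrow> real" where
  "stage_value m p f i \<alpha> =
     (if i \<le> m then divided_diff m p f \<alpha> i (\<alpha> i) else f (grid_point m p \<alpha>))"

lemma divided_diff_0:
  assumes "i \<le> m"
  shows "divided_diff m p f \<alpha> i 0 = stage_value m p f (Suc i) \<alpha>"
  using assms by (auto simp: stage_value_def)

text \<open>
  Newton's univariate formula along the line through \<open>\<alpha>\<close> in direction \<open>i\<close>. Solving the recursion
  for its first argument gives
  $F_{\alpha,i,J} = F_{\beta,i,J} + F_{\alpha,i,J+1}\,(p_{\alpha_i,i} - p_{J,i})$ with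
  $\beta = \beta^{\alpha,i,J}$, and $F_{\beta,i,J}$ is already the final value of the stage at $\beta$
  because $\beta_i = J$. Iterating this in \<open>J\<close> up to \<open>\<alpha> i\<close> leaves the claimed sum.
\<close>

lemma stage_value_newton_expansion:
  assumes i: "i \<le> m" and sep: "\<And>j. j < \<alpha> i \<Longrightarrow> p (\<alpha> i) i \<noteq> p j i"
  shows "stage_value m p f (Suc i) \<alpha> =
    (\<Sum>j\<le>\<alpha> i. stage_value m p f i (\<alpha>(i := j)) * (\<Prod>k<j. p (\<alpha> i) i - p k i))"
proof -
  let ?w = "\<lambda>j. \<Prod>k<j. p (\<alpha> i) i - p k i"
  have "divided_diff m p f \<alpha> i 0 =
      (\<Sum>j<J. stage_value m p f i (\<alpha>(i := j)) * ?w j) + divided_diff m p f \<alpha> i J * ?w J"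
    if "J \<le> \<alpha> i" for J
    using that
  proof (induction J)
    case 0
    then show ?case by simp
  next
    case (Suc J)
    have "divided_diff m p f \<alpha> i J =
        stage_value m p f i (\<alpha>(i := J)) + divided_diff m p f \<alpha> i (Suc J) * (p (\<alpha> i) i - p J i)"
      using i sep[of J] Suc.prems by (simp add: stage_value_def)
    with Suc show ?case by (simp add: algebra_simps del: divided_diff.simps fun_upd_apply)
  qed
  from this[of "\<alpha> i"] show ?thesis
    using i by (simp add: divided_diff_0 stage_value_def lessThan_Suc_atMost[symmetric]
        del: divided_diff.simps)
qed

text \<open>
  The indices below \<open>\<alpha>\<close> that agree with \<open>\<alpha>\<close> in the coordinates before \<open>i\<close>: these are the indices
  reached from \<open>\<alpha>\<close> by expanding the coordinates \<open>i, \<dots>, m\<close>.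
\<close>

definition tail_box :: "nat \<Rightarrow> nat \<Rightarrow> multi_index \<Rightarrow> multi_index set" where
  "tail_box m i \<alpha> = {\<beta>. leq_index m \<beta> \<alpha> \<and> (\<forall>l\<in>{1..<i}. \<beta> l = \<alpha> l)}"

lemma sum_tail_box_step:
  assumes "i \<in> {1..m}"
  shows "(\<Sum>\<beta>\<in>tail_box m i \<alpha>. h \<beta>) = (\<Sum>\<beta>\<in>tail_box m (Suc i) \<alpha>. \<Sum>j\<le>\<alpha> i. h (\<beta>(i := j)))"
proof -
  have "(\<Sum>\<beta>\<in>tail_box m i \<alpha>. h \<beta>) =
      (\<Sum>(\<beta>, j)\<in>tail_box m (Suc i) \<alpha> \<times> {..\<alpha> i}. h (\<beta>(i := j)))"
    using assms
    by (intro sum.reindex_bij_witness[of _ "\<lambda>(\<beta>, j). \<beta>(i := j)" "\<lambda>\<beta>. (\<beta>(i := \<alpha> i), \<beta> i)"])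
      (auto simp: tail_box_def leq_index_def fun_eq_iff less_Suc_eq intro!: multi_indices_upd)
  then show ?thesis
    by (simp add: sum.cartesian_product)
qed

text \<open>
  Each step from \<open>Suc i\<close> to \<open>i\<close> expands every summand by the univariate formula in direction \<open>i\<close>.
  The nodes that appear are those of the fixed \<open>\<alpha>\<close>, because \<open>\<beta> i = \<alpha> i\<close> holds until coordinate \<open>i\<close>
  is expanded.
\<close>

lemma value_eq_sum_stage_values:
  assumes A: "A \<subseteq> multi_indices m" "downward_closed m A" and sep: "separating_nodes m A p"
    and \<alpha>: "\<alpha> \<in> A" and i: "1 \<le> i" "i \<le> Suc m"
  shows "f (grid_point m p \<alpha>) = (\<Sum>\<beta>\<in>tail_box m i \<alpha>. stage_value m p f i \<beta> *
    (\<Prod>l\<in>{i..m}. \<Prod>k<\<beta> l. p (\<alpha> l) l - p k l))"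
  using i(2,1)
proof (induction i rule: inc_induct)
  case base
  have "tail_box m (Suc m) \<alpha> = {\<alpha>}"
    using \<alpha> A(1) by (auto simp: tail_box_def leq_index_def intro!: multi_indices_eqI[of _ m \<alpha>])
  then show ?case by (simp add: stage_value_def)
next
  case (step i)
  have i: "i \<in> {1..m}" using step by auto
  let ?w = "\<lambda>l j. \<Prod>k<j. p (\<alpha> l) l - p k l"
  have "f (grid_point m p \<alpha>) =
      (\<Sum>\<beta>\<in>tail_box m (Suc i) \<alpha>. stage_value m p f (Suc i) \<beta> * (\<Prod>l\<in>{Suc i..m}. ?w l (\<beta> l)))"
    using step by simp
  also have "\<dots> = (\<Sum>\<beta>\<in>tail_box m (Suc i) \<alpha>. \<Sum>j\<le>\<alpha> i.
      stage_value m p f i (\<beta>(i := j)) * (\<Prod>l\<in>{i..m}. ?w l ((\<beta>(i := j)) l)))"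
  proof (rule sum.cong[OF refl])
    fix \<beta> assume \<beta>: "\<beta> \<in> tail_box m (Suc i) \<alpha>"
    have bA: "\<beta> \<in> A" and bi: "\<beta> i = \<alpha> i"
      using \<beta> i downward_closedD[OF A(2) \<alpha>] by (auto simp: tail_box_def)
    have split: "(\<Prod>l\<in>{i..m}. ?w l ((\<beta>(i := j)) l)) = ?w i j * (\<Prod>l\<in>{Suc i..m}. ?w l (\<beta> l))" for j
    proof -
      have "{i..m} = insert i {Suc i..m}" using i by auto
      then show ?thesis by (simp cong: prod.cong_simp)
    qed
    have "stage_value m p f (Suc i) \<beta> = (\<Sum>j\<le>\<alpha> i. stage_value m p f i (\<beta>(i := j)) * ?w i j)"
    proof -
      have "p (\<beta> i) i \<noteq> p j i" if "j < \<beta> i" for j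
        using that sep bA i by (auto simp: separating_nodes_def)
      from stage_value_newton_expansion[of i m \<beta> p f, OF _ this] i bi show ?thesis
        by simp
    qed
    then show "stage_value m p f (Suc i) \<beta> * (\<Prod>l\<in>{Suc i..m}. ?w l (\<beta> l)) =
        (\<Sum>j\<le>\<alpha> i. stage_value m p f i (\<beta>(i := j)) * (\<Prod>l\<in>{i..m}. ?w l ((\<beta>(i := j)) l)))"
      unfolding split by (simp add: sum_distrib_right mult.assoc)
  qed
  also have "\<dots> = (\<Sum>\<beta>\<in>tail_box m i \<alpha>. stage_value m p f i \<beta> * (\<Prod>l\<in>{i..m}. ?w l (\<beta> l)))"
    by (rule sum_tail_box_step[OF i, symmetric])
  finally show ?case .
qed

text \<open>
  For \<open>i = 1\<close> the box is the set of all indices below \<open>\<alpha>\<close>. The Newton sum ranges over all of \<open>A\<close>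
  instead, but its other summands vanish at the grid point of \<open>\<alpha>\<close>.
\<close>

lemma newton_sum_interpolates:
  assumes m: "1 \<le> m" and A: "A \<subseteq> multi_indices m" "finite A" "downward_closed m A"
    and sep: "separating_nodes m A p"
  shows "interpolates m p A f (\<lambda>x. \<Sum>\<alpha>\<in>A. newton_coeff m p f \<alpha> * newton_poly m p \<alpha> x)"
proof -
  have "(\<Sum>\<beta>\<in>A. newton_coeff m p f \<beta> * newton_poly m p \<beta> (grid_point m p \<alpha>)) =
      f (grid_point m p \<alpha>)" if \<alpha>: "\<alpha> \<in> A" for \<alpha>
  proof -
    have box: "tail_box m 1 \<alpha> = {\<beta>\<in>A. leq_index m \<beta> \<alpha>}"
      using downward_closedD[OF A(3) \<alpha>] by (auto simp: tail_box_def)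
    have "f (grid_point m p \<alpha>) = (\<Sum>\<beta>\<in>tail_box m 1 \<alpha>. stage_value m p f 1 \<beta> *
        (\<Prod>l\<in>{1..m}. \<Prod>k<\<beta> l. p (\<alpha> l) l - p k l))"
      using value_eq_sum_stage_values[OF A(1,3) sep \<alpha>] m by simp
    also have "\<dots> = (\<Sum>\<beta>\<in>tail_box m 1 \<alpha>.
        newton_coeff m p f \<beta> * newton_poly m p \<beta> (grid_point m p \<alpha>))"
      using m by (intro sum.cong refl)
        (simp add: stage_value_def newton_coeff_def newton_poly_def grid_point_def)
    also have "\<dots> = (\<Sum>\<beta>\<in>A. newton_coeff m p f \<beta> * newton_poly m p \<beta> (grid_point m p \<alpha>))"
      unfolding box using A
      by (intro sum.mono_neutral_left ballI) (auto simp: newton_poly_grid_eq_0 subset_iff)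
    finally show ?thesis by simp
  qed
  then show ?thesis
    unfolding interpolates_def poly_space_eq_newton_range[OF A, of p]
    by blast
qed

section \<open>The in-place scheme\<close>

text \<open>
  A table \<open>v\<close> holds one number for each multi-index. The step \<open>(i, j, \<alpha>)\<close> overwrites
  $F_{\alpha,i,j}$ by $F_{\alpha,i,j+1}$.
\<close>

definition update :: "nodes \<Rightarrow> nat \<times> nat \<times> multi_index \<Rightarrow>
    (multi_index \<Rightarrow> real) \<Rightarrow> (multi_index \<Rightarrow> real)" where
  "update p = (\<lambda>(i, j, \<alpha>) v. v(\<alpha> := (v \<alpha> - v (\<alpha>(i := j))) / (p (\<alpha> i) i - p j i)))"

text \<open>
  Outermost the directions, then the levels \<open>j\<close>, then the indices. Filtering a product of lists makes
  distinctness immediate, so that the number of steps is the cardinality of a set of triples.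
\<close>

definition schedule :: "nat list \<Rightarrow> nat list \<Rightarrow> multi_index list \<Rightarrow> (nat \<times> nat \<times> multi_index) list" where
  "schedule is js as = filter (\<lambda>(i, j, \<alpha>). j < \<alpha> i) (List.product is (List.product js as))"

lemma set_schedule:
  "set (schedule is js as) = {(i, j, \<alpha>). i \<in> set is \<and> j \<in> set js \<and> \<alpha> \<in> set as \<and> j < \<alpha> i}"
  by (auto simp: schedule_def)

lemma distinct_schedule:
  "distinct is \<Longrightarrow> distinct js \<Longrightarrow> distinct as \<Longrightarrow> distinct (schedule is js as)"
  by (simp add: schedule_def distinct_product)

lemma schedule_append_dims: "schedule (is @ is') js as = schedule is js as @ schedule is' js as"
  by (simp add: schedule_def product_concat_map)

lemma schedule_append_steps: "schedule [i] (js @ js') as = schedule [i] js as @ schedule [i] js' as"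
  by (simp add: schedule_def product_concat_map)

lemma schedule_single: "schedule [i] [j] as = map (\<lambda>\<alpha>. (i, j, \<alpha>)) (filter (\<lambda>\<alpha>. j < \<alpha> i) as)"
  by (simp add: schedule_def filter_map comp_def)

text \<open>
  Within one level \<open>j\<close> the order of the updates does not matter: an updated index has entry larger
  than \<open>j\<close> at \<open>i\<close>, whereas the second operand \<open>\<gamma>(i := j)\<close> has entry exactly \<open>j\<close>. So no update
  disturbs an operand of another one, and overwriting in place is safe.
\<close>

lemma fold_update_sweep:
  assumes "distinct as" "\<And>\<alpha>. \<alpha> \<in> set as \<Longrightarrow> j < \<alpha> i"
  shows "fold (update p) (map (\<lambda>\<alpha>. (i, j, \<alpha>)) as) v \<gamma> =
    (if \<gamma> \<in> set as then (v \<gamma> - v (\<gamma>(i := j))) / (p (\<gamma> i) i - p j i) else v \<gamma>)"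
  using assms
proof (induction as arbitrary: v)
  case (Cons \<alpha> as)
  have ne: "\<gamma>(i := j) \<noteq> \<alpha>"
    using Cons.prems(2)[of \<alpha>] by auto
  define u where "u = update p (i, j, \<alpha>) v"
  have "u (\<gamma>(i := j)) = v (\<gamma>(i := j))"
    using ne by (simp add: u_def update_def)
  moreover have "u \<gamma> = (if \<gamma> = \<alpha> then (v \<gamma> - v (\<gamma>(i := j))) / (p (\<gamma> i) i - p j i) else v \<gamma>)"
    by (simp add: u_def update_def)
  moreover have "fold (update p) (map (\<lambda>\<alpha>. (i, j, \<alpha>)) (\<alpha> # as)) v \<gamma> =
      fold (update p) (map (\<lambda>\<alpha>. (i, j, \<alpha>)) as) u \<gamma>"
    by (simp add: u_def)
  ultimately show ?case
    using Cons.IH[of u] Cons.prems by (auto simp del: fun_upd_apply)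
qed simp

text \<open>
  After \<open>J\<close> levels, indices with \<open>\<gamma> i \<le> J\<close> have reached the end of the stage and rest there. This is
  why at level \<open>J\<close> the operand \<open>\<gamma>(i := J)\<close> holds the required value of order \<open>J\<close>.
\<close>

lemma fold_update_dimension:
  assumes A: "downward_closed m A" "A \<subseteq> multi_indices m" and as: "distinct as" "set as = A"
    and i: "i \<in> {1..m}" and v: "\<And>\<gamma>. \<gamma> \<in> A \<Longrightarrow> v \<gamma> = divided_diff m p f \<gamma> i 0"
    and \<gamma>: "\<gamma> \<in> A"
  shows "fold (update p) (schedule [i] [0..<J] as) v \<gamma> = divided_diff m p f \<gamma> i (min J (\<gamma> i))"
  using \<gamma>
proof (induction J arbitrary: \<gamma>)
  case 0
  then show ?case using v by (simp add: schedule_def del: divided_diff.simps)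
next
  case (Suc J)
  let ?u = "fold (update p) (schedule [i] [0..<J] as) v"
  have "fold (update p) (schedule [i] [0..<Suc J] as) v \<gamma> =
      fold (update p) (map (\<lambda>\<alpha>. (i, J, \<alpha>)) (filter (\<lambda>\<alpha>. J < \<alpha> i) as)) ?u \<gamma>"
    by (simp add: schedule_append_steps schedule_single)
  also have "\<dots> =
      (if J < \<gamma> i then (?u \<gamma> - ?u (\<gamma>(i := J))) / (p (\<gamma> i) i - p J i) else ?u \<gamma>)"
    using as Suc.prems by (subst fold_update_sweep) auto
  also have "\<dots> = divided_diff m p f \<gamma> i (min (Suc J) (\<gamma> i))"
  proof (cases "J < \<gamma> i")
    case True
    then have "\<gamma>(i := J) \<in> A"
      using downward_closed_upd[OF A Suc.prems i] by simp
    then have "?u (\<gamma>(i := J)) = divided_diff m p f (\<gamma>(i := J)) i J"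
      by (subst Suc.IH) auto
    then show ?thesis
      using True Suc.IH[OF Suc.prems] by (simp add: min_def del: fun_upd_apply)
  next
    case False
    then show ?thesis
      using Suc.IH[OF Suc.prems] by (simp add: min_def)
  qed
  finally show ?case .
qed

text \<open>
  By \<open>entry_less_card\<close>, \<open>card A\<close> levels suffice in every direction.
\<close>

lemma fold_update_schedule:
  assumes A: "downward_closed m A" "A \<subseteq> multi_indices m" "finite A"
    and as: "distinct as" "set as = A"
    and i: "1 \<le> i" "i \<le> Suc m" and \<gamma>: "\<gamma> \<in> A"
  shows "fold (update p) (schedule (rev [i..<Suc m]) [0..<card A] as) (\<lambda>\<alpha>. f (grid_point m p \<alpha>)) \<gamma>
    = stage_value m p f i \<gamma>"
  using i(2,1) \<gamma>
proof (induction i arbitrary: \<gamma> rule: inc_induct)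
  case base
  then show ?case by (simp add: stage_value_def schedule_def)
next
  case (step i)
  have i: "i \<in> {1..m}" using step by auto
  let ?v = "fold (update p) (schedule (rev [Suc i..<Suc m]) [0..<card A] as)
    (\<lambda>\<alpha>. f (grid_point m p \<alpha>))"
  have v: "?v \<beta> = divided_diff m p f \<beta> i 0" if "\<beta> \<in> A" for \<beta>
    using step.IH[OF _ that] i by (simp add: divided_diff_0 del: divided_diff.simps)
  have "rev [i..<Suc m] = rev [Suc i..<Suc m] @ [i]"
    using i by (simp add: upt_rec[of i])
  then have "fold (update p) (schedule (rev [i..<Suc m]) [0..<card A] as)
      (\<lambda>\<alpha>. f (grid_point m p \<alpha>)) \<gamma> = fold (update p) (schedule [i] [0..<card A] as) ?v \<gamma>"
    by (simp only: schedule_append_dims fold_append comp_apply)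
  also have "\<dots> = divided_diff m p f \<gamma> i (min (card A) (\<gamma> i))"
    using step.prems by (intro fold_update_dimension[OF A(1,2) as i v]) auto
  also have "\<dots> = stage_value m p f i \<gamma>"
    using i entry_less_card[OF A step.prems(2) i] by (simp add: stage_value_def min_def)
  finally show ?case .
qed

section \<open>Compilation to a straight-line program\<close>

text \<open>
  Registers \<open>0\<close> and \<open>1\<close> are scratch space. The nodes are loaded afresh for every update, so they
  occupy no further registers.
\<close>

definition update_code :: "(multi_index \<Rightarrow> nat) \<Rightarrow> nat \<times> nat \<times> multi_index \<Rightarrow> instr list" where
  "update_code out = (\<lambda>(i, j, \<alpha>).
     [Load 0 (Node (\<alpha> i) i), Load 1 (Node j i), Arith 0 Sub 0 1,
      Arith (out \<alpha>) Sub (out \<alpha>) (out (\<alpha>(i := j))), Arith (out \<alpha>) Div (out \<alpha>) 0])"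

definition newton_program ::
    "(multi_index \<Rightarrow> nat) \<Rightarrow> multi_index list \<Rightarrow> (nat \<times> nat \<times> multi_index) list \<Rightarrow> instr list" where
  "newton_program out as sched =
     map (\<lambda>\<alpha>. Load (out \<alpha>) (Value \<alpha>)) as @ concat (map (update_code out) sched)"

text \<open>
  The refinement relation between machine memory and tables.
\<close>

definition holds :: "(multi_index \<Rightarrow> nat) \<Rightarrow> multi_index set \<Rightarrow> memory \<Rightarrow> (multi_index \<Rightarrow> real) \<Rightarrow> bool" where
  "holds out A M v \<longleftrightarrow> (\<forall>\<alpha>\<in>A. M (out \<alpha>) = Some (v \<alpha>))"

lemma run_append:
  "run inp (cs @ ds) M = (case run inp cs M of None \<Rightarrow> None | Some M' \<Rightarrow> run inp ds M')"
  by (induction cs arbitrary: M) (auto split: option.splits)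

text \<open>
  The set \<open>B\<close> of values already loaded generalizes the claim for the induction over \<open>as\<close>.
\<close>

lemma run_loads:
  assumes "inj_on out A" "set as \<subseteq> A" "holds out B M v" "B \<subseteq> A" "\<And>\<alpha>. \<alpha> \<in> A \<Longrightarrow> inp (Value \<alpha>) = Some (v \<alpha>)"
  shows "\<exists>M'. run inp (map (\<lambda>\<alpha>. Load (out \<alpha>) (Value \<alpha>)) as) M = Some M' \<and> holds out (B \<union> set as) M' v"
  using assms(2-4)
proof (induction as arbitrary: M B)
  case (Cons \<alpha> as)
  have "holds out (insert \<alpha> B) (M(out \<alpha> \<mapsto> v \<alpha>)) v"
    using Cons.prems assms(1) by (auto simp: holds_def dest: inj_onD)
  from Cons.IH[OF _ this] show ?case
    using Cons.prems assms(5) by (simp del: fun_upd_apply)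
qed simp

text \<open>
  Registers from \<open>2\<close> on and injectivity of \<open>out\<close> ensure that neither the scratch registers nor the
  written cell collide with other entries of the table.
\<close>

lemma run_update_code:
  assumes out: "inj_on out A" "\<And>\<alpha>. \<alpha> \<in> A \<Longrightarrow> 2 \<le> out \<alpha>"
    and \<alpha>: "\<alpha> \<in> A" "\<alpha>(i := j) \<in> A" and ne: "p (\<alpha> i) i \<noteq> p j i"
    and inp: "inp (Node (\<alpha> i) i) = Some (p (\<alpha> i) i)" "inp (Node j i) = Some (p j i)"
    and M: "holds out A M v"
  shows "\<exists>M'. run inp (update_code out (i, j, \<alpha>)) M = Some M' \<and>
    holds out A M' (update p (i, j, \<alpha>) v)"
proof -
  let ?M' = "M(0 \<mapsto> p (\<alpha> i) i - p j i, 1 \<mapsto> p j i,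
    out \<alpha> \<mapsto> (v \<alpha> - v (\<alpha>(i := j))) / (p (\<alpha> i) i - p j i))"
  have ge: "out \<beta> \<noteq> 0" "out \<beta> \<noteq> 1" "out \<beta> \<noteq> Suc 0" if "\<beta> \<in> A" for \<beta>
    using out(2)[OF that] by auto
  have Mv: "M (out \<beta>) = Some (v \<beta>)" if "\<beta> \<in> A" for \<beta>
    using M that by (auto simp: holds_def)
  have "run inp (update_code out (i, j, \<alpha>)) M = Some ?M'"
    using ne inp ge[OF \<alpha>(1)] ge[OF \<alpha>(2)] Mv[OF \<alpha>(1)] Mv[OF \<alpha>(2)]
    by (auto simp: update_code_def fun_eq_iff)
  moreover have "holds out A ?M' (update p (i, j, \<alpha>) v)"
    unfolding holds_def
  proof
    fix \<beta> assume \<beta>: "\<beta> \<in> A"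
    have "out \<beta> = out \<alpha> \<longleftrightarrow> \<beta> = \<alpha>"
      using inj_on_eq_iff[OF out(1) \<beta> \<alpha>(1)] .
    then show "?M' (out \<beta>) = Some (update p (i, j, \<alpha>) v \<beta>)"
      using ge[OF \<beta>] Mv[OF \<beta>] by (simp add: update_def)
  qed
  ultimately show ?thesis by blast
qed

lemma run_updates:
  assumes out: "inj_on out A" "\<And>\<alpha>. \<alpha> \<in> A \<Longrightarrow> 2 \<le> out \<alpha>"
    and A: "downward_closed m A" "A \<subseteq> multi_indices m" "finite A"
    and p: "admissible_nodes m A n p"
    and sched: "set sched \<subseteq> {(i, j, \<alpha>). i \<in> {1..m} \<and> \<alpha> \<in> A \<and> j < \<alpha> i}"
    and M: "holds out A M v"
  shows "\<exists>M'. run (problem_input m A n p f) (concat (map (update_code out) sched)) M = Some M' \<and>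
    holds out A M' (fold (update p) sched v)"
  using sched M
proof (induction sched arbitrary: M v)
  case (Cons t sched)
  obtain i j \<alpha> where t: "t = (i, j, \<alpha>)" by (cases t)
  then have *: "i \<in> {1..m}" "\<alpha> \<in> A" "j < \<alpha> i"
    using Cons.prems by auto
  then have ne: "p (\<alpha> i) i \<noteq> p j i"
    using admissible_imp_separating[OF p A(3)] by (auto simp: separating_nodes_def)
  obtain M1 where M1: "run (problem_input m A n p f) (update_code out t) M = Some M1"
      "holds out A M1 (update p t v)"
  proof -
    have "\<alpha>(i := j) \<in> A" "\<alpha> i \<le> n i"
      using * downward_closed_upd[OF A(1,2) *(2,1)] admissible_imp_le[OF p A(3) *(2,1)] by auto
    then have "\<exists>M1. run (problem_input m A n p f) (update_code out (i, j, \<alpha>)) M = Some M1 \<and>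
        holds out A M1 (update p (i, j, \<alpha>) v)"
      using * by (intro run_update_code out ne Cons.prems(2)) auto
    then show ?thesis using that t by blast
  qed
  then show ?case
    using Cons.IH[OF _ M1(2)] Cons.prems(1) by (auto simp: run_append)
qed simp

lemma newton_program_computes:
  assumes m: "1 \<le> m" and out: "inj_on out A" "\<And>\<alpha>. \<alpha> \<in> A \<Longrightarrow> 2 \<le> out \<alpha>"
    and A: "downward_closed m A" "A \<subseteq> multi_indices m" "finite A"
    and as: "distinct as" "set as = A"
    and p: "admissible_nodes m A n p"
  shows "computes (problem_input m A n p f)
    (newton_program out as (schedule (rev [1..<Suc m]) [0..<card A] as)) out A (newton_coeff m p f)"
proof -
  let ?inp = "problem_input m A n p f" and ?sched = "schedule (rev [1..<Suc m]) [0..<card A] as"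
  let ?v = "\<lambda>\<alpha>. f (grid_point m p \<alpha>)"
  obtain M where M: "run ?inp (map (\<lambda>\<alpha>. Load (out \<alpha>) (Value \<alpha>)) as) Map.empty = Some M"
      "holds out A M ?v"
    using run_loads[OF out(1), of as "{}" Map.empty ?v ?inp] as(2) by (auto simp: holds_def)
  have "set ?sched \<subseteq> {(i, j, \<alpha>). i \<in> {1..m} \<and> \<alpha> \<in> A \<and> j < \<alpha> i}"
    using as(2) by (auto simp: set_schedule)
  from run_updates[OF out A p this M(2)] obtain M' where
    M': "run ?inp (concat (map (update_code out) ?sched)) M = Some M'"
      "holds out A M' (fold (update p) ?sched ?v)" by blast
  have "fold (update p) ?sched ?v \<alpha> = newton_coeff m p f \<alpha>" if "\<alpha> \<in> A" for \<alpha>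
    using fold_update_schedule[OF A as _ _ that, of 1] m
    by (simp add: stage_value_def newton_coeff_def)
  then show ?thesis
    using M(1) M' unfolding computes_def newton_program_def by (auto simp: run_append holds_def)
qed

lemma operations_newton_program: "operations (newton_program out as sched) = 3 * length sched"
proof -
  have "filter is_arith (map (\<lambda>\<alpha>. Load (out \<alpha>) (Value \<alpha>)) as) = []"
    by (induction as) auto
  moreover have "length (filter is_arith (concat (map (update_code out) sched))) = 3 * length sched"
    by (induction sched) (auto simp: update_code_def)
  ultimately show ?thesis by (simp add: operations_def newton_program_def)
qed

text \<open>
  Two scratch registers, one register and one input value for each element of \<open>A\<close>, and the nodes
  counted by \<open>card_nodes_le\<close>. A direction with \<open>\<alpha> i = 0\<close> for all \<open>\<alpha> \<in> A\<close> causes no update and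
  hence no access to its nodes.
\<close>

lemma storage_newton_program:
  assumes A: "downward_closed m A" "A \<subseteq> multi_indices m" "finite A" and as: "set as = A"
    and sched: "set sched \<subseteq> {(i, j, \<alpha>). i \<in> {1..m} \<and> \<alpha> \<in> A \<and> j < \<alpha> i}"
  shows "storage (newton_program out as sched) \<le> 4 * card A + 2"
proof -
  let ?prog = "newton_program out as sched"
  let ?N = "{Node k i |k i. \<exists>\<alpha>\<in>A. i \<in> {1..m} \<and> k \<le> \<alpha> i \<and> 0 < \<alpha> i}"
  have prog: "set ?prog = (\<lambda>\<alpha>. Load (out \<alpha>) (Value \<alpha>)) ` A \<union> (\<Union>t\<in>set sched. set (update_code out t))"
    by (simp add: newton_program_def as)
  have code: "\<Union>(registers ` set (update_code out t)) \<subseteq> {0, 1} \<union> out ` A \<and>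
      \<Union>(inputs ` set (update_code out t)) \<subseteq> ?N" if "t \<in> set sched" for t
  proof -
    obtain i j \<alpha> where t: "t = (i, j, \<alpha>)" "i \<in> {1..m}" "\<alpha> \<in> A" "j < \<alpha> i"
      using \<open>t \<in> set sched\<close> sched by blast
    have "\<alpha>(i := j) \<in> A"
      using downward_closed_upd[OF A(1,2) t(3,2)] t(4) by simp
    moreover have "Node (\<alpha> i) i \<in> ?N" "Node j i \<in> ?N"
      using t(2-4) less_imp_le[OF t(4)] gr_implies_not0[OF t(4)] by blast+
    ultimately show ?thesis
      using t(3) unfolding t(1) by (simp add: update_code_def)
  qed
  have "\<Union>(registers ` set ?prog) = out ` A \<union> (\<Union>t\<in>set sched. \<Union>(registers ` set (update_code out t)))"
    unfolding prog by auto
  also have "\<dots> \<subseteq> {0, 1} \<union> out ` A"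
    using code by (intro Un_least UN_least) blast+
  finally have "\<Union>(registers ` set ?prog) \<subseteq> {0, 1} \<union> out ` A" .
  then have "card (\<Union>(registers ` set ?prog)) \<le> card ({0, 1} \<union> out ` A)"
    using A(3) by (intro card_mono) auto
  also have "\<dots> \<le> 2 + card A"
    using card_Un_le[of "{0, 1}" "out ` A"] card_image_le[OF A(3), of out] by simp
  finally have regs: "card (\<Union>(registers ` set ?prog)) \<le> 2 + card A" .
  have "\<Union>(inputs ` set ?prog) = Value ` A \<union> (\<Union>t\<in>set sched. \<Union>(inputs ` set (update_code out t)))"
    unfolding prog by auto
  also have "\<dots> \<subseteq> Value ` A \<union> ?N"
    using code by (intro Un_least UN_least) blast+
  finally have "\<Union>(inputs ` set ?prog) \<subseteq> Value ` A \<union> ?N" .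
  then have "card (\<Union>(inputs ` set ?prog)) \<le> card (Value ` A \<union> ?N)"
    using A(3) card_nodes_le(1)[OF A(1,3)] by (intro card_mono) auto
  also have "\<dots> \<le> card A + 2 * card A"
    by (rule order_trans[OF card_Un_le]) (intro add_mono card_image_le A card_nodes_le(2))
  finally show ?thesis
    using regs by (simp add: storage_def)
qed

text \<open>
  The program depends on \<open>m\<close> and \<open>A\<close> alone; one and the same program serves all nodes and values.
  The constant \<open>6\<close> comes from storage, since \<open>4 * card A + 2 \<le> 6 * card A\<close> for nonempty \<open>A\<close>.
\<close>

lemma newton_program_exists:
  assumes m: "1 \<le> m" and A: "downward_closed m A" "A \<subseteq> multi_indices m" "finite A" "A \<noteq> {}"
  shows "\<exists>prog out. operations prog \<le> 6 * (card A)\<^sup>2 \<and> storage prog \<le> 6 * card A \<and>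
    (\<forall>n p f. admissible_nodes m A n p \<longrightarrow>
       computes (problem_input m A n p f) prog out A (newton_coeff m p f))"
proof -
  obtain as where as: "distinct as" "set as = A"
    using finite_distinct_list[OF A(3)] by blast
  obtain g :: "multi_index \<Rightarrow> nat" where g: "inj_on g A"
    using finite_imp_inj_to_nat_seg[OF A(3)] by blast
  define out where "out \<alpha> = g \<alpha> + 2" for \<alpha>
  have out: "inj_on out A" "\<And>\<alpha>. \<alpha> \<in> A \<Longrightarrow> 2 \<le> out \<alpha>"
    using g by (auto simp: out_def inj_on_def)
  define sched where "sched = schedule (rev [1..<Suc m]) [0..<card A] as"
  have sub: "set sched \<subseteq> {(i, j, \<alpha>). i \<in> {1..m} \<and> \<alpha> \<in> A \<and> j < \<alpha> i}"
    using as(2) by (auto simp: sched_def set_schedule)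
  have "{(i, j, \<alpha>). i \<in> {1..m} \<and> \<alpha> \<in> A \<and> j < \<alpha> i} \<subseteq> {1..m} \<times> {..<card A} \<times> A"
    using less_trans[OF _ entry_less_card[OF A(1-3)]] by (clarsimp simp del: atLeastAtMost_iff)
  then have fin: "finite {(i, j, \<alpha>). i \<in> {1..m} \<and> \<alpha> \<in> A \<and> j < \<alpha> i}"
    using A(3) by (auto intro: finite_subset)
  have "length sched = card (set sched)"
    using as(1) by (simp add: sched_def distinct_schedule distinct_card)
  also have "\<dots> \<le> (card A)\<^sup>2"
    using card_mono[OF fin sub] card_predecessors_le[OF A(1-3)] by linarith
  finally have "operations (newton_program out as sched) \<le> 6 * (card A)\<^sup>2"
    by (simp add: operations_newton_program)
  moreover have "storage (newton_program out as sched) \<le> 6 * card A"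
  proof -
    have "card A > 0" using A by (simp add: card_gt_0_iff)
    then show ?thesis
      using storage_newton_program[OF A(1-3) as(2) sub, of out] by linarith
  qed
  ultimately show ?thesis
    using newton_program_computes[OF m out A(1-3) as] unfolding sched_def by blast
qed

section \<open>Interpolation on downward closed sets\<close>

theorem theorem5:
  shows "\<exists>C::nat. \<forall>(m::nat) (A::multi_index set).
    1 \<le> m \<longrightarrow> A \<subseteq> multi_indices m \<longrightarrow> finite A \<longrightarrow> A \<noteq> {} \<longrightarrow> downward_closed m A \<longrightarrow>
    (\<exists>(prog::instr list) (out::multi_index \<Rightarrow> nat).
       operations prog \<le> C * (card A)\<^sup>2 \<and>
       storage prog \<le> C * card A \<and>
       (\<forall>(n::nat \<Rightarrow> nat) (p::nodes) (f::point \<Rightarrow> real). admissible_nodes m A n p \<longrightarrow>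
          (\<exists>!Q. interpolates m p A f Q) \<and>
          (THE Q. interpolates m p A f Q) =
            (\<lambda>x. \<Sum>\<alpha>\<in>A. newton_coeff m p f \<alpha> * newton_poly m p \<alpha> x) \<and>
          computes (problem_input m A n p f) prog out A (newton_coeff m p f)))"
proof (rule exI[of _ 6], intro allI impI)
  fix m :: nat and A :: "multi_index set"
  assume m: "1 \<le> m" and A: "A \<subseteq> multi_indices m" "finite A" "A \<noteq> {}" "downward_closed m A"
  obtain prog out where prog: "operations prog \<le> 6 * (card A)\<^sup>2" "storage prog \<le> 6 * card A"
      "\<And>n p f. admissible_nodes m A n p \<Longrightarrow>
         computes (problem_input m A n p f) prog out A (newton_coeff m p f)"
    using newton_program_exists[OF m A(4,1,2,3)] by blast
  have int: "(\<exists>!Q. interpolates m p A f Q) \<and> (THE Q. interpolates m p A f Q) =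
      (\<lambda>x. \<Sum>\<alpha>\<in>A. newton_coeff m p f \<alpha> * newton_poly m p \<alpha> x)"
    if "admissible_nodes m A n p" for n p f
  proof -
    note sep = admissible_imp_separating[OF that A(2)]
    note ex = newton_sum_interpolates[OF m A(1,2,4) sep, of f]
    have ex1: "\<exists>!Q. interpolates m p A f Q"
      using ex interpolant_unique[OF A(1,2,4) sep] by blast
    then show ?thesis
      using interpolant_unique[OF A(1,2,4) sep theI'[OF ex1] ex] by blast
  qed
  show "\<exists>prog out. operations prog \<le> 6 * (card A)\<^sup>2 \<and> storage prog \<le> 6 * card A \<and>
       (\<forall>n p f. admissible_nodes m A n p \<longrightarrow>
          (\<exists>!Q. interpolates m p A f Q) \<and>
          (THE Q. interpolates m p A f Q) =
            (\<lambda>x. \<Sum>\<alpha>\<in>A. newton_coeff m p f \<alpha> * newton_poly m p \<alpha> x) \<and>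
          computes (problem_input m A n p f) prog out A (newton_coeff m p f))"
    by (rule exI[of _ prog], rule exI[of _ out]) (use prog int in simp)
qed

end
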